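(* Let $X\subseteq\mathbb{R}^m$ and $Y\subseteq\mathbb{R}^n$ be nonempty, compact and convex, and let $\mathcal{Q}(x)=\inf\{f(y,x):y\in Y\}$ for $x\in X$, where $f$ is differentiable and convex on $Y\times X$. Let $\bar x\in X$, $\varepsilon\ge0$, and let $\hat y(\varepsilon)\in Y$ be an $\varepsilon$-optimal solution of $\inf\{f(y,\bar x):y\in Y\}$, i.e. $\mathcal{Q}(\bar x)\ge f(\hat y(\varepsilon),\bar x)-\varepsilon$. Set $\eta(\varepsilon)=\ell_1(\hat y(\varepsilon),\bar x):=\max_{y\in Y}\langle\nabla_yf(\hat y(\varepsilon),\bar x),\hat y(\varepsilon)-y\rangle$. Then the affine function $$\mathcal{C}(x)=f(\hat y(\varepsilon),\bar x)-\eta(\varepsilon)+\langle\nabla_xf(\hat y(\varepsilon),\bar x),x-\bar x\rangle$$ is a cut for $\mathcal{Q}$ at $\bar x$. Moreover, if there exists $M_1>0$ such that $\|\nabla_yf(y_2,x)-\nabla_yf(y_1,x)\|\le M_1\|y_2-y_1\|$ for every $x\in X$, $y_1,y_2\in Y$, then, setting $$\varepsilon_0=\begin{cases}\dfrac{\ell_1(\hat y(\varepsilon),\bar x)}{2M_1\mathrm{Diam}(Y)^2}\big(2M_1\mathrm{Diam}(Y)^2-\ell_1(\hat y(\varepsilon),\bar x)\big)&\text{if }\ell_1(\hat y(\varepsilon),\bar x)\le M_1\mathrm{Diam}(Y)^2,\\[2mm]\frac12\ell_1(\hat y(\varepsilon),\bar x)&\text{otherwise,}\end{cases}$$ the distance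 $\mathcal{Q}(\bar x)-\mathcal{C}(\bar x)$ is at most $\varepsilon_0$.
   Context: A cut for $\mathcal{Q}$ is an affine function $\mathcal{C}$ with $\mathcal{Q}(x)\ge\mathcal{C}(x)$ for all $x\in X$. $\mathrm{Diam}(Y)=\max_{x,y\in Y}\|x-y\|$ (Euclidean norm). $\nabla_yf,\nabla_xf$ denote partial gradients of $f(y,x)$. *)

theory Defs
  imports "HOL-Analysis.Analysis"
begin

text \<open>
  The set \<open>S\<close> may have empty interior, in which case \<open>g\<close> need not be unique.
  For \<open>z\<close> interior to \<open>S\<close> this is \<open>GDERIV f z :> g\<close>.
\<close>
definition has_gradient_within ::
    "('a::real_inner \<Rightarrow> real) \<Rightarrow> 'a \<Rightarrow> 'a \<Rightarrow> 'a set \<Rightarrow> bool" where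
  "has_gradient_within f g z S \<longleftrightarrow> (f has_derivative (\<lambda>h. g \<bullet> h)) (at z within S)"

text \<open>
  \<open>gy\<close> and \<open>gx\<close> play the roles of $\nabla_y f$ and $\nabla_x f$. They are passed
  around explicitly because the derivatives are taken relative to \<open>Y\<close> and \<open>X\<close>,
  whose interiors may be empty.
\<close>
definition partial_gradients ::
    "((real^'n) \<times> (real^'m) \<Rightarrow> real) \<Rightarrow> (real^'n) set \<Rightarrow> (real^'m) set \<Rightarrow>
     ((real^'n) \<times> (real^'m) \<Rightarrow> real^'n) \<Rightarrow> ((real^'n) \<times> (real^'m) \<Rightarrow> real^'m) \<Rightarrow> bool" where
  "partial_gradients f Y X gy gx \<longleftrightarrow>
     (\<forall>y\<in>Y. \<forall>x\<in>X.
        has_gradient_within (\<lambda>y'. f (y', x)) (gy (y, x)) y Y \<and>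
        has_gradient_within (\<lambda>x'. f (y, x')) (gx (y, x)) x X)"

definition value_fun ::
    "((real^'n) \<times> (real^'m) \<Rightarrow> real) \<Rightarrow> (real^'n) set \<Rightarrow> real^'m \<Rightarrow> real" where
  "value_fun f Y x = (INF y\<in>Y. f (y, x))"

definition is_cut :: "(real^'m) set \<Rightarrow> (real^'m \<Rightarrow> real) \<Rightarrow> (real^'m \<Rightarrow> real) \<Rightarrow> bool" where
  "is_cut X Q C \<longleftrightarrow> (\<exists>a b. \<forall>x. C x = a \<bullet> x + b) \<and> (\<forall>x\<in>X. Q x \<ge> C x)"

text \<open>The supremum is a maximum when \<open>Y\<close> is nonempty and compact.\<close>
definition ell1 ::
    "(real^'n) set \<Rightarrow> ((real^'n) \<times> (real^'m) \<Rightarrow> real^'n) \<Rightarrow> real^'n \<Rightarrow> real^'m \<Rightarrow> real" where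
  "ell1 Y gy yh xb = (SUP y\<in>Y. gy (yh, xb) \<bullet> (yh - y))"

definition inexact_cut ::
    "((real^'n) \<times> (real^'m) \<Rightarrow> real) \<Rightarrow> (real^'n) set \<Rightarrow>
     ((real^'n) \<times> (real^'m) \<Rightarrow> real^'n) \<Rightarrow> ((real^'n) \<times> (real^'m) \<Rightarrow> real^'m) \<Rightarrow>
     real^'n \<Rightarrow> real^'m \<Rightarrow> real^'m \<Rightarrow> real" where
  "inexact_cut f Y gy gx yh xb x =
     f (yh, xb) - ell1 Y gy yh xb + gx (yh, xb) \<bullet> (x - xb)"

text \<open>
  \<open>l\<close> and \<open>D\<close> stand for $\ell_1(\hat y,\bar x)$ and $\mathrm{Diam}(Y)$. If \<open>Y\<close> is a
  singleton then \<open>D = l = 0\<close>, and the quotient \<open>0 / 0\<close> has value \<open>0\<close>, so \<open>eps0 M1 D l = 0\<close>.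
\<close>
definition eps0 :: "real \<Rightarrow> real \<Rightarrow> real \<Rightarrow> real" where
  "eps0 M1 D l =
     (if l \<le> M1 * D\<^sup>2 then l / (2 * M1 * D\<^sup>2) * (2 * M1 * D\<^sup>2 - l) else l / 2)"

end

theory Submission
  imports Defs
begin

text \<open>
  By convexity, \<open>f\<close> lies above its linearization at \<open>(yh, xb)\<close>. Replacing the part of the
  linearization that is linear in \<open>y\<close> by its minimum \<open>- ell1\<close> over \<open>Y\<close> gives a lower bound for
  \<open>f (y, x)\<close> that does not depend on \<open>y\<close>, and this bound is the cut. The sets \<open>Y\<close> and \<open>X\<close> may have
  empty interior, so \<open>gy\<close>, \<open>gx\<close> and the joint derivative of \<open>f\<close> need not be determined by \<open>f\<close>. Their
  values on feasible directions \<open>w - z\<close> are determined, however, because they are one-sided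
  derivatives along segments (\<open>has_derivative_within_convex_unique\<close>); linearity of the joint
  derivative then splits it into the two partial gradients on \<open>(y - yh, x - xb)\<close>.

  For the distance, \<open>Q xb - C xb = ell1 - (f (yh, xb) - Q xb)\<close>, so the task is to show that \<open>yh\<close> can
  be improved substantially when \<open>ell1\<close> is large. Let \<open>v\<close> in \<open>Y\<close> attain the maximum in \<open>ell1\<close>. A step
  of length \<open>t\<close> from \<open>yh\<close> towards \<open>v\<close>, as in the conditional gradient method, decreases \<open>f\<close> by at
  least \<open>t * ell1 - M1 * t\<^sup>2 * Diam\<^sup>2 / 2\<close> (\<open>descent_lemma_within\<close>). The best \<open>t\<close> in \<open>[0, 1]\<close> is
  \<open>ell1 / (M1 * Diam\<^sup>2)\<close> or \<open>1\<close>, and these are the two cases of \<open>eps0\<close>.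
\<close>

section \<open>Derivatives along segments of a convex set\<close>

lemma segment_point_in_convex:
  assumes "convex S" "z \<in> S" "w \<in> S" "0 \<le> t" "t \<le> (1::real)"
  shows "z + t *\<^sub>R (w - z) \<in> S"
proof -
  have "z + t *\<^sub>R (w - z) = (1 - t) *\<^sub>R z + t *\<^sub>R w"
    by (simp add: algebra_simps)
  with assms show ?thesis by (simp add: convexD)
qed

lemma has_derivative_along_segment:
  fixes f :: "'a::real_normed_vector \<Rightarrow> real"
  assumes "convex S" "z \<in> S" "w \<in> S"
    and "(f has_derivative f') (at (z + t *\<^sub>R (w - z)) within S)"
  shows "((\<lambda>s. f (z + s *\<^sub>R (w - z))) has_real_derivative f' (w - z)) (at t within {0..1})"
proof -
  have sub: "(\<lambda>s. z + s *\<^sub>R (w - z)) ` {0..1} \<subseteq> S"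
    using segment_point_in_convex[OF assms(1-3)] by auto
  have seg: "((\<lambda>s. z + s *\<^sub>R (w - z)) has_derivative (\<lambda>s. s *\<^sub>R (w - z))) (at t within {0..1})"
    by (auto intro!: derivative_eq_intros)
  have "((\<lambda>s. f (z + s *\<^sub>R (w - z))) has_derivative (\<lambda>s. f' (s *\<^sub>R (w - z)))) (at t within {0..1})"
    using has_derivative_in_compose[OF seg has_derivative_subset[OF assms(4) sub]] .
  moreover have "(\<lambda>s. f' (s *\<^sub>R (w - z))) = (*) (f' (w - z))"
    using linear_scale[OF has_derivative_linear[OF assms(4)]] by (auto simp: mult.commute)
  ultimately show ?thesis by (simp add: has_field_derivative_def)
qed

text \<open>
  A derivative relative to a set with empty interior is not unique as a linear map. On a feasible
  direction, however, it is the limit of one-sided difference quotients taken inside the set.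
\<close>
lemma has_derivative_within_convex_unique:
  fixes f :: "'a::real_normed_vector \<Rightarrow> real"
  assumes "convex S" "z \<in> S" "w \<in> S"
    and "(f has_derivative L1) (at z within S)" "(f has_derivative L2) (at z within S)"
  shows "L1 (w - z) = L2 (w - z)"
proof -
  have lim: "((\<lambda>s. (f (z + s *\<^sub>R (w - z)) - f z) / s) \<longlongrightarrow> L (w - z)) (at_right 0)"
    if "(f has_derivative L) (at z within S)" for L
    using has_derivative_along_segment[OF assms(1-3), of f L 0] that
    by (simp add: has_field_derivative_iff at_within_Icc_at_right)
  show ?thesis
    by (rule tendsto_unique[OF _ lim[OF assms(4)] lim[OF assms(5)]]) simp
qed

text \<open>
  Convexity bounds every difference quotient along the segment by \<open>f w - f z\<close>; the inequality
  follows in the limit, and so it also holds for \<open>z\<close> on the boundary of \<open>S\<close>.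
\<close>
lemma convex_on_above_linearization_within:
  fixes f :: "'a::real_normed_vector \<Rightarrow> real"
  assumes "convex_on S f" "z \<in> S" "w \<in> S"
    and "(f has_derivative f') (at z within S)"
  shows "f z + f' (w - z) \<le> f w"
proof -
  have "convex S" using assms(1) by (rule convex_on_imp_convex)
  have lim: "((\<lambda>s. (f (z + s *\<^sub>R (w - z)) - f z) / s) \<longlongrightarrow> f' (w - z)) (at_right 0)"
    using has_derivative_along_segment[OF \<open>convex S\<close> assms(2,3), of f f' 0] assms(4)
    by (simp add: has_field_derivative_iff at_within_Icc_at_right)
  have quot: "(f (z + s *\<^sub>R (w - z)) - f z) / s \<le> f w - f z" if "0 < s" "s < 1" for s
  proof -
    have "f ((1 - s) *\<^sub>R z + s *\<^sub>R w) \<le> (1 - s) * f z + s * f w"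
      using convex_onD[OF assms(1), of s z w] that assms(2,3) by simp
    moreover have "(1 - s) *\<^sub>R z + s *\<^sub>R w = z + s *\<^sub>R (w - z)"
      by (simp add: algebra_simps)
    ultimately show ?thesis using that by (simp add: field_simps)
  qed
  have "eventually (\<lambda>s. (f (z + s *\<^sub>R (w - z)) - f z) / s \<le> f w - f z) (at_right 0)"
    using eventually_at_right_real[of 0 1] by (rule eventually_mono) (auto intro: quot)
  then have "f' (w - z) \<le> f w - f z"
    by (intro tendsto_upperbound[OF lim]) auto
  then show ?thesis by simp
qed

text \<open>
  The integral form of the remainder would give the factor \<open>1/2\<close>; here the same factor comes from
  monotonicity: the right side minus the left side, as a function of the position on the segment,
  vanishes at the start and has nonnegative derivative.
\<close>
lemma descent_lemma_within:
  fixes f :: "'a::real_inner \<Rightarrow> real"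
  assumes "convex S" "z \<in> S" "w \<in> S"
    and grad: "\<And>y. y \<in> S \<Longrightarrow> has_gradient_within f (g y) y S"
    and lip: "\<And>y. y \<in> S \<Longrightarrow> norm (g y - g z) \<le> M * norm (y - z)"
    and "0 \<le> t" "t \<le> 1"
  shows "f (z + t *\<^sub>R (w - z)) \<le> f z + t * (g z \<bullet> (w - z)) + M * t\<^sup>2 * (norm (w - z))\<^sup>2 / 2"
proof -
  define d where "d = w - z"
  define p where "p s = s * (g z \<bullet> d) + M * s\<^sup>2 * (norm d)\<^sup>2 / 2 - f (z + s *\<^sub>R d)" for s
  define p' where "p' s = g z \<bullet> d + M * s * (norm d)\<^sup>2 - g (z + s *\<^sub>R d) \<bullet> d" for s
  have in_S: "z + s *\<^sub>R d \<in> S" if "0 \<le> s" "s \<le> 1" for s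
    using segment_point_in_convex[OF assms(1-3) that] by (simp add: d_def)
  have der: "(p has_real_derivative p' s) (at s within {0..1})" if "s \<in> {0..1}" for s
  proof -
    have "((\<lambda>s. f (z + s *\<^sub>R d)) has_real_derivative g (z + s *\<^sub>R d) \<bullet> d) (at s within {0..1})"
      using has_derivative_along_segment[OF assms(1-3), of f "\<lambda>h. g (z + s *\<^sub>R d) \<bullet> h" s]
        grad[OF in_S, of s] that
      by (simp add: has_gradient_within_def d_def)
    then show ?thesis
      unfolding p_def[abs_def] p'_def by (auto intro!: derivative_eq_intros)
  qed
  have nonneg: "0 \<le> p' s" if "0 \<le> s" "s \<le> 1" for s
  proof -
    have "(g (z + s *\<^sub>R d) - g z) \<bullet> d \<le> norm (g (z + s *\<^sub>R d) - g z) * norm d"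
      by (rule norm_cauchy_schwarz)
    also have "\<dots> \<le> M * norm (s *\<^sub>R d) * norm d"
      using lip[OF in_S[OF that]] by (intro mult_right_mono) auto
    finally show ?thesis
      using that by (simp add: p'_def inner_diff_left power2_eq_square mult.assoc)
  qed
  have "p 0 \<le> p t"
  proof (rule DERIV_nonneg_imp_increasing_open[OF \<open>0 \<le> t\<close>])
    show "continuous_on {0..t} p"
      by (rule continuous_on_subset[OF DERIV_continuous_on[OF der]]) (use \<open>t \<le> 1\<close> in auto)
    show "\<exists>D. DERIV p s :> D \<and> 0 \<le> D" if "0 < s" "s < t" for s
    proof -
      have "DERIV p s :> p' s"
        using der[of s] that \<open>t \<le> 1\<close> at_within_Icc_at[of 0 s 1] by simp
      then show ?thesis using nonneg[of s] that \<open>t \<le> 1\<close> by auto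
    qed
  qed
  then show ?thesis by (simp add: p_def d_def)
qed

section \<open>The cut\<close>

lemma ell1_attained:
  fixes gy :: "(real^'n) \<times> (real^'m) \<Rightarrow> real^'n"
  assumes "compact Y" "Y \<noteq> {}"
  obtains v where "v \<in> Y" "ell1 Y gy yh xb = gy (yh, xb) \<bullet> (yh - v)"
    "\<And>y. y \<in> Y \<Longrightarrow> gy (yh, xb) \<bullet> (yh - y) \<le> ell1 Y gy yh xb"
proof -
  have "continuous_on Y (\<lambda>y. gy (yh, xb) \<bullet> (yh - y))"
    by (intro continuous_intros)
  from continuous_attains_sup[OF assms this] obtain v where v: "v \<in> Y"
    "\<And>y. y \<in> Y \<Longrightarrow> gy (yh, xb) \<bullet> (yh - y) \<le> gy (yh, xb) \<bullet> (yh - v)" by auto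
  then have "ell1 Y gy yh xb = gy (yh, xb) \<bullet> (yh - v)"
    unfolding ell1_def by (intro cSup_eq_maximum) auto
  with v that show thesis by auto
qed

text \<open>
  Restricting the joint derivative to either factor gives a second derivative of the partial
  function, which has to agree with the given gradient on feasible directions.
\<close>
lemma joint_derivative_eq_partial_gradients:
  fixes gy :: "(real^'n) \<times> (real^'m) \<Rightarrow> real^'n"
  assumes "convex Y" "convex X" "partial_gradients f Y X gy gx"
    and mem: "y0 \<in> Y" "x0 \<in> X" "y \<in> Y" "x \<in> X"
    and F: "(f has_derivative F) (at (y0, x0) within Y \<times> X)"
  shows "F (y - y0, x - x0) = gy (y0, x0) \<bullet> (y - y0) + gx (y0, x0) \<bullet> (x - x0)"
proof -
  have grad: "((\<lambda>y. f (y, x0)) has_derivative (\<lambda>h. gy (y0, x0) \<bullet> h)) (at y0 within Y)"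
    "((\<lambda>x. f (y0, x)) has_derivative (\<lambda>h. gx (y0, x0) \<bullet> h)) (at x0 within X)"
    using assms(3) mem by (auto simp: partial_gradients_def has_gradient_within_def)
  have "((\<lambda>y. f (y, x0)) has_derivative (\<lambda>h. F (h, 0))) (at y0 within Y)"
    by (rule has_derivative_in_compose[where f = "\<lambda>y. (y, x0)" and f' = "\<lambda>h. (h, 0)",
          OF _ has_derivative_subset[OF F]])
      (use mem in \<open>auto intro!: has_derivative_Pair has_derivative_const has_derivative_ident\<close>)
  from has_derivative_within_convex_unique[OF assms(1) mem(1,3) this grad(1)]
  have "F (y - y0, 0) = gy (y0, x0) \<bullet> (y - y0)" .
  moreover have "((\<lambda>x. f (y0, x)) has_derivative (\<lambda>h. F (0, h))) (at x0 within X)"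
    by (rule has_derivative_in_compose[where f = "\<lambda>x. (y0, x)" and f' = "\<lambda>h. (0, h)",
          OF _ has_derivative_subset[OF F]])
      (use mem in \<open>auto intro!: has_derivative_Pair has_derivative_const has_derivative_ident\<close>)
  from has_derivative_within_convex_unique[OF assms(2) mem(2,4) this grad(2)]
  have "F (0, x - x0) = gx (y0, x0) \<bullet> (x - x0)" .
  moreover have "F (y - y0, x - x0) = F (y - y0, 0) + F (0, x - x0)"
    using linear_add[OF has_derivative_linear[OF F], of "(y - y0, 0)" "(0, x - x0)"] by simp
  ultimately show ?thesis by simp
qed

text \<open>
  This bound for each single \<open>y\<close> does more than prove the cut property: it also shows that the
  values \<open>f (y, x)\<close> are bounded below, so that the infimum of these real numbers is a lower bound.
\<close>
lemma inexact_cut_le: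
  fixes gy :: "(real^'n) \<times> (real^'m) \<Rightarrow> real^'n"
  assumes "compact Y" "convex Y" "convex X"
    and "f differentiable_on (Y \<times> X)" "convex_on (Y \<times> X) f" "partial_gradients f Y X gy gx"
    and mem: "yh \<in> Y" "xb \<in> X" "y \<in> Y" "x \<in> X"
  shows "inexact_cut f Y gy gx yh xb x \<le> f (y, x)"
proof -
  obtain F where F: "(f has_derivative F) (at (yh, xb) within Y \<times> X)"
    using assms(4) mem by (auto simp: differentiable_on_def differentiable_def)
  have "f (yh, xb) + F ((y, x) - (yh, xb)) \<le> f (y, x)"
    by (rule convex_on_above_linearization_within[OF assms(5) _ _ F]) (use mem in auto)
  moreover have "F (y - yh, x - xb) = gy (yh, xb) \<bullet> (y - yh) + gx (yh, xb) \<bullet> (x - xb)"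
    by (rule joint_derivative_eq_partial_gradients[OF assms(2,3,6) mem F])
  moreover have "gy (yh, xb) \<bullet> (yh - y) \<le> ell1 Y gy yh xb"
    using ell1_attained[OF assms(1), of gy yh xb] mem by blast
  ultimately show ?thesis
    by (simp add: inexact_cut_def inner_diff_right)
qed

lemma value_fun_le:
  assumes "\<And>y. y \<in> Y \<Longrightarrow> c \<le> f (y, x)" "y \<in> Y"
  shows "value_fun f Y x \<le> f (y, x)"
  unfolding value_fun_def using assms by (intro cINF_lower bdd_belowI2[of _ c]) auto

section \<open>The distance to the value function\<close>

text \<open>
  The right side of the last inequality is the decrease guaranteed by a step of length \<open>t\<close>, a
  concave quadratic in \<open>t\<close>. If \<open>l \<le> M * D\<^sup>2\<close> and \<open>D > 0\<close>, its maximum over \<open>[0, 1]\<close> is attained at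
  \<open>l / (M * D\<^sup>2)\<close> and equals \<open>l - eps0 M D l\<close>. If \<open>l > M * D\<^sup>2\<close>, it is increasing on \<open>[0, 1]\<close>, and its
  value \<open>l - M * D\<^sup>2 / 2\<close> at \<open>1\<close> exceeds \<open>l / 2 = l - eps0 M D l\<close>.
\<close>
lemma eps0_step_length:
  assumes "0 < M" "0 \<le> D" "0 \<le> l"
  obtains t where "0 \<le> t" "t \<le> 1" "l - eps0 M D l \<le> t * l - M * t\<^sup>2 * D\<^sup>2 / 2"
proof (cases "l \<le> M * D\<^sup>2")
  case True
  show thesis
  proof (cases "D = 0")
    case True
    with \<open>l \<le> M * D\<^sup>2\<close> assms show thesis by (intro that[of 0]) (auto simp: eps0_def)
  next
    case False
    define K where "K = M * D\<^sup>2"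
    have "0 < K" "l \<le> K"
      using \<open>D \<noteq> 0\<close> \<open>l \<le> M * D\<^sup>2\<close> assms by (simp_all add: K_def)
    have "M * (l / K)\<^sup>2 * D\<^sup>2 = K * (l / K)\<^sup>2" by (simp add: K_def)
    moreover have "eps0 M D l = l / (2 * K) * (2 * K - l)"
      using \<open>l \<le> M * D\<^sup>2\<close> by (simp add: eps0_def K_def mult.assoc)
    moreover have "l - l / (2 * K) * (2 * K - l) = l / K * l - K * (l / K)\<^sup>2 / 2"
      using \<open>0 < K\<close> by (simp add: field_simps power2_eq_square)
    ultimately show thesis
      using \<open>0 < K\<close> \<open>l \<le> K\<close> assms by (intro that[of "l / K"]) auto
  qed
next
  case False
  then show thesis by (intro that[of 1]) (auto simp: eps0_def)
qed

lemma value_fun_gap_le_eps0: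
  fixes gy :: "(real^'n) \<times> (real^'m) \<Rightarrow> real^'n"
  assumes "compact Y" "convex Y" "convex X"
    and "f differentiable_on (Y \<times> X)" "convex_on (Y \<times> X) f" "partial_gradients f Y X gy gx"
    and mem: "yh \<in> Y" "xb \<in> X"
    and "0 < M"
    and lip: "\<And>y1 y2. y1 \<in> Y \<Longrightarrow> y2 \<in> Y \<Longrightarrow>
      norm (gy (y2, xb) - gy (y1, xb)) \<le> M * norm (y2 - y1)"
  shows "value_fun f Y xb - inexact_cut f Y gy gx yh xb xb
    \<le> eps0 M (diameter Y) (ell1 Y gy yh xb)"
proof -
  let ?l = "ell1 Y gy yh xb" and ?D = "diameter Y"
  obtain v where v: "v \<in> Y" "?l = gy (yh, xb) \<bullet> (yh - v)"
    and max: "\<And>y. y \<in> Y \<Longrightarrow> gy (yh, xb) \<bullet> (yh - y) \<le> ?l"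
    using ell1_attained[OF assms(1)] mem(1) by blast
  have "0 \<le> ?l" using max[OF mem(1)] by simp
  have bdd: "bounded Y" using assms(1) by (rule compact_imp_bounded)
  obtain t where t: "0 \<le> t" "t \<le> 1" and gain: "?l - eps0 M ?D ?l \<le> t * ?l - M * t\<^sup>2 * ?D\<^sup>2 / 2"
    using eps0_step_length[OF \<open>0 < M\<close> diameter_ge_0[OF bdd] \<open>0 \<le> ?l\<close>] .
  define u where "u = yh + t *\<^sub>R (v - yh)"
  have "u \<in> Y"
    unfolding u_def by (rule segment_point_in_convex[OF assms(2) mem(1) v(1) t])
  then have "value_fun f Y xb \<le> f (u, xb)"
    using value_fun_le inexact_cut_le[OF assms(1-6) mem _ mem(2)] by blast
  also have "\<dots> \<le> f (yh, xb) + t * (gy (yh, xb) \<bullet> (v - yh)) + M * t\<^sup>2 * (norm (v - yh))\<^sup>2 / 2"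
    unfolding u_def
    by (rule descent_lemma_within[where f = "\<lambda>y. f (y, xb)" and g = "\<lambda>y. gy (y, xb)",
          OF assms(2) mem(1) v(1) _ lip[OF mem(1)] t])
      (use assms(6) mem(2) in \<open>auto simp: partial_gradients_def\<close>)
  also have "gy (yh, xb) \<bullet> (v - yh) = - ?l"
    by (simp add: v(2) inner_diff_right)
  also have "M * t\<^sup>2 * (norm (v - yh))\<^sup>2 \<le> M * t\<^sup>2 * ?D\<^sup>2"
    using diameter_bounded_bound[OF bdd v(1) mem(1)] \<open>0 < M\<close>
    by (intro mult_left_mono power_mono) (auto simp: dist_norm)
  finally show ?thesis
    using gain by (simp add: inexact_cut_def)
qed

theorem proposition2p3:
  fixes X :: "(real^'m) set" and Y :: "(real^'n) set"
    and f :: "(real^'n) \<times> (real^'m) \<Rightarrow> real"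
    and gy :: "(real^'n) \<times> (real^'m) \<Rightarrow> real^'n"
    and gx :: "(real^'n) \<times> (real^'m) \<Rightarrow> real^'m"
    and xb :: "real^'m" and yh :: "real^'n" and \<epsilon> :: real
  assumes "X \<noteq> {}" "compact X" "convex X"
    and "Y \<noteq> {}" "compact Y" "convex Y"
    and "f differentiable_on (Y \<times> X)"
    and "convex_on (Y \<times> X) f"
    and "partial_gradients f Y X gy gx"
    and "xb \<in> X" and "\<epsilon> \<ge> 0" and "yh \<in> Y"
    and "value_fun f Y xb \<ge> f (yh, xb) - \<epsilon>"
  shows "is_cut X (value_fun f Y) (inexact_cut f Y gy gx yh xb) \<and>
    (\<forall>M1>0. (\<forall>x\<in>X. \<forall>y1\<in>Y. \<forall>y2\<in>Y. norm (gy (y2, x) - gy (y1, x)) \<le> M1 * norm (y2 - y1)) \<longrightarrow>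
       value_fun f Y xb - inexact_cut f Y gy gx yh xb xb
         \<le> eps0 M1 (diameter Y) (ell1 Y gy yh xb))"
proof (intro conjI allI impI)
  note hyps = assms(5,6,3,7,8,9,12,10)
  show "is_cut X (value_fun f Y) (inexact_cut f Y gy gx yh xb)"
    unfolding is_cut_def
  proof (intro conjI exI ballI allI)
    show "inexact_cut f Y gy gx yh xb x
      = gx (yh, xb) \<bullet> x + (f (yh, xb) - ell1 Y gy yh xb - gx (yh, xb) \<bullet> xb)" for x
      by (simp add: inexact_cut_def inner_diff_right)
    show "inexact_cut f Y gy gx yh xb x \<le> value_fun f Y x" if "x \<in> X" for x
      unfolding value_fun_def
      by (rule cINF_greatest[OF assms(4)]) (rule inexact_cut_le[OF hyps _ that])
  qed
  show "value_fun f Y xb - inexact_cut f Y gy gx yh xb xb \<le> eps0 M1 (diameter Y) (ell1 Y gy yh xb)"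
    if "0 < M1" "\<forall>x\<in>X. \<forall>y1\<in>Y. \<forall>y2\<in>Y. norm (gy (y2, x) - gy (y1, x)) \<le> M1 * norm (y2 - y1)" for M1
    by (rule value_fun_gap_le_eps0[OF hyps that(1)]) (use that(2) assms(10) in blast)
qed

end
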